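(* For each positive integer $n$, $\mathrm{ic}(K_{2n}) = \binom{2n}{n}$ and $\mathrm{ic}(K_{2n-1}) = 2\binom{2n-1}{n}$, where $K_r$ is the complete graph on $r$ labeled vertices. Furthermore, $\mathrm{mix}(\mathcal{C}) = n^2$ for all $\mathcal{C} \in \mathrm{IC}(K_{2n})$, and $\mathrm{mix}(\mathcal{C}) = n^2-n$ for all $\mathcal{C} \in \mathrm{IC}(K_{2n-1})$.
   Context: Let $G=(V,E)$ be a finite labeled graph. A coloring of $G$ is an arbitrary map $\mathcal{C}: V \to \{\text{black},\text{white}\}$. An edge is balanced if its endpoints have different colors, and unbalanced otherwise. The mixing number $\mathrm{mix}(\mathcal{C})$ is the number of balanced edges of $G$. For a vertex $v$, $\mathrm{mix}(v)$ is the number of balanced edges incident to $v$. A vertex $v$ is integrated if $\mathrm{mix}(v)\geq \frac12\deg(v)$, and $\mathcal{C}$ is integrated if every vertex is integrated. $\mathrm{IC}(G)$ is the set of all integrated colorings of $G$ and $\mathrm{ic}(G)=|\mathrm{IC}(G)|$. *)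

theory Defs
  imports Complex_Main "HOL-Library.FuncSet"
begin

text \<open>
  A graph is undirected and simple: an edge is the set of its two endpoints.
\<close>

datatype 'a graph = Graph (verts: "'a set") (edges: "'a set set")

definition finite_graph :: "'a graph \<Rightarrow> bool" where
  "finite_graph G \<longleftrightarrow>
     finite (verts G) \<and> (\<forall>e \<in> edges G. e \<subseteq> verts G \<and> card e = 2)"

definition incident_edges :: "'a graph \<Rightarrow> 'a \<Rightarrow> 'a set set" where
  "incident_edges G v = {e \<in> edges G. v \<in> e}"

definition degree :: "'a graph \<Rightarrow> 'a \<Rightarrow> nat" where
  "degree G v = card (incident_edges G v)"

datatype color = Black | White

text \<open>
  A coloring is a map on the vertex set only. To make such maps countable objects, they are
  taken to be \<^const>\<open>undefined\<close> outside the vertex set.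
\<close>

definition colorings :: "'a graph \<Rightarrow> ('a \<Rightarrow> color) set" where
  "colorings G = verts G \<rightarrow>\<^sub>E (UNIV :: color set)"

definition balanced :: "('a \<Rightarrow> color) \<Rightarrow> 'a set \<Rightarrow> bool" where
  "balanced C e \<longleftrightarrow> (\<exists>u v. e = {u, v} \<and> C u \<noteq> C v)"

definition mix :: "'a graph \<Rightarrow> ('a \<Rightarrow> color) \<Rightarrow> nat" where
  "mix G C = card {e \<in> edges G. balanced C e}"

definition mix_at :: "'a graph \<Rightarrow> ('a \<Rightarrow> color) \<Rightarrow> 'a \<Rightarrow> nat" where
  "mix_at G C v = card {e \<in> incident_edges G v. balanced C e}"

definition integrated_at :: "'a graph \<Rightarrow> ('a \<Rightarrow> color) \<Rightarrow> 'a \<Rightarrow> bool" where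
  "integrated_at G C v \<longleftrightarrow> real (mix_at G C v) \<ge> 1 / 2 * real (degree G v)"

definition integrated :: "'a graph \<Rightarrow> ('a \<Rightarrow> color) \<Rightarrow> bool" where
  "integrated G C \<longleftrightarrow> (\<forall>v \<in> verts G. integrated_at G C v)"

definition IC :: "'a graph \<Rightarrow> ('a \<Rightarrow> color) set" where
  "IC G = {C \<in> colorings G. integrated G C}"

definition ic :: "'a graph \<Rightarrow> nat" where
  "ic G = card (IC G)"

definition complete_graph :: "nat \<Rightarrow> nat graph" where
  "complete_graph r = Graph {1..r} {e. e \<subseteq> {1..r} \<and> card e = 2}"

lemma finite_graph_complete_graph: "finite_graph (complete_graph r)"
  by (simp add: finite_graph_def complete_graph_def)

lemma finite_IC:
  assumes "finite_graph G"
  shows "finite (IC G)"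
proof -
  have "(UNIV :: color set) = {Black, White}"
    using color.exhaust by auto
  then have "finite (UNIV :: color set)"
    by (metis finite.emptyI finite.insertI)
  then have "finite (colorings G)"
    using assms by (auto simp: colorings_def finite_graph_def intro!: finite_PiE)
  then show ?thesis
    by (simp add: IC_def)
qed

end

theory Submission
  imports Defs
begin

text \<open>
  Split the vertices of \<open>K\<^sub>r\<close> into the black class, of size \<open>b\<close>, and the white class, of size
  \<open>w\<close>. The balanced edges are exactly those joining the two classes, so a black vertex has \<open>w\<close> of
  them among its \<open>b + w - 1\<close> incident edges and is integrated iff \<open>b \<le> w + 1\<close>; a white vertex is
  integrated iff \<open>w \<le> b + 1\<close>. Each inequality also holds trivially when the class it comes from is
  empty, so a coloring is integrated iff the two class sizes differ by at most one
  (lemma \<open>integrated_complete_graph_iff\<close>).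

  A coloring is determined by its black class, and every vertex set is one, so integrated colorings
  are counted by subsets of prescribed size: \<open>b = n\<close> if \<open>r = 2 n\<close>, and \<open>b = n - 1\<close> or \<open>b = n\<close> if
  \<open>r = 2 n - 1\<close>. In both cases there are \<open>b w\<close> balanced edges in total
  (lemma \<open>mix_complete_graph\<close>), which depends on \<open>n\<close> only.
\<close>

definition color_class :: "nat \<Rightarrow> (nat \<Rightarrow> color) \<Rightarrow> color \<Rightarrow> nat set" where
  "color_class r C c = {v \<in> {1..r}. C v = c}"

lemma neq_color_iff: "c \<noteq> Black \<longleftrightarrow> c = White" "c \<noteq> White \<longleftrightarrow> c = Black"
  by (cases c; simp)+

lemma finite_color_class [simp]: "finite (color_class r C c)"
  by (simp add: color_class_def)

lemma card_color_classes: "card (color_class r C Black) + card (color_class r C White) = r"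
proof -
  have "color_class r C Black \<union> color_class r C White = {1..r}"
    by (auto simp: neq_color_iff color_class_def)
  moreover have "color_class r C Black \<inter> color_class r C White = {}"
    by (auto simp: color_class_def)
  ultimately show ?thesis
    by (metis card_Un_disjoint card_atLeastAtMost diff_Suc_1 finite_color_class)
qed

lemma balanced_doubleton [simp]: "balanced C {u, v} \<longleftrightarrow> C u \<noteq> C v"
  by (auto simp: balanced_def doubleton_eq_iff)

lemma edges_complete_graph:
  "edges (complete_graph r) = {{u, v} | u v. u \<in> {1..r} \<and> v \<in> {1..r} \<and> u \<noteq> v}"
  by (auto simp: complete_graph_def card_2_iff) blast

lemma incident_edges_complete_graph:
  assumes "v \<in> {1..r}"
  shows "incident_edges (complete_graph r) v = (\<lambda>u. {v, u}) ` ({1..r} - {v})"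
  using assms by (auto simp: incident_edges_def edges_complete_graph) blast

lemma inj_on_doubleton: "inj_on (\<lambda>u. {v, u}) A"
  by (auto simp: inj_on_def doubleton_eq_iff)

lemma degree_complete_graph:
  assumes "v \<in> {1..r}"
  shows "degree (complete_graph r) v = r - 1"
  using assms
  by (simp add: degree_def incident_edges_complete_graph card_image inj_on_doubleton)

lemma mix_at_complete_graph:
  assumes "v \<in> {1..r}"
  shows "mix_at (complete_graph r) C v = card {u \<in> {1..r}. C u \<noteq> C v}"
proof -
  have "{e \<in> incident_edges (complete_graph r) v. balanced C e}
      = (\<lambda>u. {v, u}) ` {u \<in> {1..r}. C u \<noteq> C v}"
    using assms by (auto simp: incident_edges_complete_graph)
  then show ?thesis
    by (simp add: mix_at_def card_image inj_on_doubleton)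
qed

lemma integrated_at_complete_graph:
  assumes "v \<in> {1..r}"
  shows "integrated_at (complete_graph r) C v \<longleftrightarrow> r \<le> 2 * card {u \<in> {1..r}. C u \<noteq> C v} + 1"
  using assms
  by (auto simp: integrated_at_def mix_at_complete_graph degree_complete_graph of_nat_diff)

text \<open>
  Substituting \<open>r = b + w\<close>, the condition \<open>r \<le> 2 w + 1\<close> at a black vertex reads \<open>b \<le> w + 1\<close>, and
  symmetrically at a white one. The equivalence survives an empty class because then the inequality
  that its vertices would impose is \<open>0 \<le> w + 1\<close> or \<open>0 \<le> b + 1\<close>.
\<close>

lemma integrated_complete_graph_iff:
  fixes r :: nat and C :: "nat \<Rightarrow> color"
  defines "b \<equiv> card (color_class r C Black)"
    and "w \<equiv> card (color_class r C White)"
  shows "integrated (complete_graph r) C \<longleftrightarrow> b \<le> w + 1 \<and> w \<le> b + 1"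
proof -
  have sum: "b + w = r"
    unfolding b_def w_def by (rule card_color_classes)
  have black: "integrated_at (complete_graph r) C v \<longleftrightarrow> b \<le> w + 1"
    if "v \<in> color_class r C Black" for v
  proof -
    have "{u \<in> {1..r}. C u \<noteq> C v} = color_class r C White"
      using that by (auto simp: neq_color_iff color_class_def)
    moreover have "v \<in> {1..r}"
      using that by (simp add: color_class_def)
    ultimately have "integrated_at (complete_graph r) C v \<longleftrightarrow> r \<le> 2 * w + 1"
      by (simp only: integrated_at_complete_graph w_def)
    then show ?thesis
      using sum by linarith
  qed
  have white: "integrated_at (complete_graph r) C v \<longleftrightarrow> w \<le> b + 1"
    if "v \<in> color_class r C White" for v
  proof -
    have "{u \<in> {1..r}. C u \<noteq> C v} = color_class r C Black"
      using that by (auto simp: neq_color_iff color_class_def)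
    moreover have "v \<in> {1..r}"
      using that by (simp add: color_class_def)
    ultimately have "integrated_at (complete_graph r) C v \<longleftrightarrow> r \<le> 2 * b + 1"
      by (simp only: integrated_at_complete_graph b_def)
    then show ?thesis
      using sum by linarith
  qed
  have "verts (complete_graph r) = color_class r C Black \<union> color_class r C White"
    by (auto simp: neq_color_iff complete_graph_def color_class_def)
  then have "integrated (complete_graph r) C \<longleftrightarrow>
      (\<forall>v \<in> color_class r C Black. integrated_at (complete_graph r) C v) \<and>
      (\<forall>v \<in> color_class r C White. integrated_at (complete_graph r) C v)"
    by (simp add: integrated_def ball_Un)
  also have "\<dots> \<longleftrightarrow> (color_class r C Black \<noteq> {} \<longrightarrow> b \<le> w + 1) \<and>
      (color_class r C White \<noteq> {} \<longrightarrow> w \<le> b + 1)"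
    using black white by auto
  also have "\<dots> \<longleftrightarrow> b \<le> w + 1 \<and> w \<le> b + 1"
    by (auto simp: b_def w_def)
  finally show ?thesis .
qed

text \<open>
  Every balanced edge has one black and one white endpoint, so listing the black one first
  identifies balanced edges with pairs.
\<close>

lemma mix_complete_graph:
  "mix (complete_graph r) C = card (color_class r C Black) * card (color_class r C White)"
proof -
  let ?P = "color_class r C Black \<times> color_class r C White"
  have "{e \<in> edges (complete_graph r). balanced C e} = (\<lambda>(u, v). {u, v}) ` ?P" (is "?L = ?R")
  proof
    show "?L \<subseteq> ?R"
    proof
      fix e assume "e \<in> ?L"
      then obtain u v where e: "e = {u, v}" "u \<in> {1..r}" "v \<in> {1..r}" "C u \<noteq> C v"
        by (auto simp: edges_complete_graph)
      then have "(u, v) \<in> ?P \<or> (v, u) \<in> ?P"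
        by (cases "C u"; cases "C v") (auto simp: color_class_def)
      then show "e \<in> ?R"
        using e(1) by (auto simp: image_iff insert_commute)
    qed
    show "?R \<subseteq> ?L"
      by (auto simp: edges_complete_graph color_class_def) fastforce
  qed
  moreover have "inj_on (\<lambda>(u, v). {u, v}) ?P"
    by (auto simp: inj_on_def doubleton_eq_iff color_class_def)
  ultimately show ?thesis
    by (simp add: mix_def card_image card_cartesian_product)
qed

lemma bij_betw_black_class:
  "bij_betw (\<lambda>C. color_class r C Black) (colorings (complete_graph r)) (Pow {1..r})"
proof (rule bij_betw_byWitness[where
      f' = "\<lambda>B. restrict (\<lambda>v. if v \<in> B then Black else White) {1..r}"])
  show "\<forall>C \<in> colorings (complete_graph r).
      restrict (\<lambda>v. if v \<in> color_class r C Black then Black else White) {1..r} = C"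
  proof
    fix C assume "C \<in> colorings (complete_graph r)"
    then have "C \<in> extensional {1..r}"
      by (simp add: colorings_def complete_graph_def PiE_def)
    then show "restrict (\<lambda>v. if v \<in> color_class r C Black then Black else White) {1..r} = C"
      by (auto simp: neq_color_iff fun_eq_iff color_class_def extensional_def)
  qed
qed (auto simp: color_class_def colorings_def complete_graph_def split: if_splits)

lemma card_colorings_black_class:
  "card {C \<in> colorings (complete_graph r). card (color_class r C Black) \<in> K}
    = card {B. B \<subseteq> {1..r} \<and> card B \<in> K}"
proof -
  let ?black = "\<lambda>C. color_class r C Black"
  let ?S = "{C \<in> colorings (complete_graph r). card (?black C) \<in> K}"
  have "?black ` ?S = {B \<in> ?black ` colorings (complete_graph r). card B \<in> K}"
    by auto
  also have "\<dots> = {B. B \<subseteq> {1..r} \<and> card B \<in> K}"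
    using bij_betw_imp_surj_on[OF bij_betw_black_class[of r]] by auto
  finally have "?black ` ?S = {B. B \<subseteq> {1..r} \<and> card B \<in> K}" .
  moreover have "inj_on ?black ?S"
    using bij_betw_imp_inj_on[OF bij_betw_black_class[of r]] by (rule inj_on_subset) auto
  ultimately show ?thesis
    using card_image by fastforce
qed

lemma IC_complete_graph_even:
  "IC (complete_graph (2 * n))
    = {C \<in> colorings (complete_graph (2 * n)). card (color_class (2 * n) C Black) \<in> {n}}"
proof -
  have "integrated (complete_graph (2 * n)) C \<longleftrightarrow> card (color_class (2 * n) C Black) = n" for C
    using card_color_classes[of "2 * n" C] unfolding integrated_complete_graph_iff by arith
  then show ?thesis
    by (simp add: IC_def)
qed

lemma IC_complete_graph_odd:
  assumes "n \<ge> 1"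
  shows "IC (complete_graph (2 * n - 1))
    = {C \<in> colorings (complete_graph (2 * n - 1)).
        card (color_class (2 * n - 1) C Black) \<in> {n - 1, n}}"
proof -
  have "b \<le> w + 1 \<and> w \<le> b + 1 \<longleftrightarrow> b = n - 1 \<or> b = n" if "b + w = 2 * n - 1" for b w
    using that assms by presburger
  then have "integrated (complete_graph (2 * n - 1)) C \<longleftrightarrow>
      card (color_class (2 * n - 1) C Black) \<in> {n - 1, n}" for C
    by (simp only: integrated_complete_graph_iff card_color_classes insert_iff empty_iff simp_thms)
  then show ?thesis
    by (simp add: IC_def)
qed

theorem theorem1:
  fixes n :: nat
  assumes "n \<ge> 1"
  shows "ic (complete_graph (2 * n)) = (2 * n) choose n
    \<and> ic (complete_graph (2 * n - 1)) = 2 * ((2 * n - 1) choose n)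
    \<and> (\<forall>C \<in> IC (complete_graph (2 * n)). mix (complete_graph (2 * n)) C = n ^ 2)
    \<and> (\<forall>C \<in> IC (complete_graph (2 * n - 1)). mix (complete_graph (2 * n - 1)) C = n ^ 2 - n)"
proof (intro conjI ballI)
  show "ic (complete_graph (2 * n)) = (2 * n) choose n"
    unfolding ic_def IC_complete_graph_even card_colorings_black_class by (simp add: n_subsets)
next
  have "{B. B \<subseteq> {1..2 * n - 1} \<and> card B \<in> {n - 1, n}}
      = {B. B \<subseteq> {1..2 * n - 1} \<and> card B = n - 1} \<union> {B. B \<subseteq> {1..2 * n - 1} \<and> card B = n}"
    by auto
  then have "card {B. B \<subseteq> {1..2 * n - 1} \<and> card B \<in> {n - 1, n}}
      = card {B. B \<subseteq> {1..2 * n - 1} \<and> card B = n - 1}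
        + card {B. B \<subseteq> {1..2 * n - 1} \<and> card B = n}"
    using assms by (simp only:) (rule card_Un_disjoint; auto)
  also have "\<dots> = ((2 * n - 1) choose (n - 1)) + ((2 * n - 1) choose n)"
    by (simp add: n_subsets)
  also have "(2 * n - 1) choose (n - 1) = (2 * n - 1) choose n"
    using binomial_symmetric[of n "2 * n - 1"] assms by (simp add: mult_2)
  finally show "ic (complete_graph (2 * n - 1)) = 2 * ((2 * n - 1) choose n)"
    unfolding ic_def IC_complete_graph_odd[OF assms] card_colorings_black_class by simp
next
  fix C assume "C \<in> IC (complete_graph (2 * n))"
  then have "card (color_class (2 * n) C Black) = n"
    unfolding IC_complete_graph_even by simp
  moreover from this have "card (color_class (2 * n) C White) = n"
    using card_color_classes[of "2 * n" C] by simp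
  ultimately show "mix (complete_graph (2 * n)) C = n ^ 2"
    by (simp add: mix_complete_graph power2_eq_square)
next
  fix C assume C: "C \<in> IC (complete_graph (2 * n - 1))"
  let ?b = "card (color_class (2 * n - 1) C Black)"
  let ?w = "card (color_class (2 * n - 1) C White)"
  have "?b = n - 1 \<or> ?b = n"
    using C unfolding IC_complete_graph_odd[OF assms] by simp
  then have "?b = n - 1 \<and> ?w = n \<or> ?b = n \<and> ?w = n - 1"
    using card_color_classes[of "2 * n - 1" C] assms by arith
  then have "?b * ?w = n * (n - 1)"
    by auto
  then show "mix (complete_graph (2 * n - 1)) C = n ^ 2 - n"
    by (simp add: mix_complete_graph power2_eq_square right_diff_distrib')
qed

end
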